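(* Let $L/K$ be a finite separable extension of fields and let $H_1, H_2$ be two Hopf algebras giving Hopf-Galois structures on $L/K$ whose actions on $L$ commute, i.e. $h_1\cdot(h_2\cdot x) = h_2\cdot(h_1\cdot x)$ for all $h_1\in H_1$, $h_2\in H_2$, $x\in L$. Then an element $x\in L$ generates $L$ as an $H_1$-module if and only if it generates $L$ as an $H_2$-module.
   Context: A Hopf-Galois structure on $L/K$ is a $K$-Hopf algebra $H$ together with an action of $H$ on $L$ making $L$ an $H$-module algebra such that the natural map $L\otimes_K H\to \mathrm{End}_K(L)$ is a bijection; in this case $L$ is a free $H$-module of rank $1$. *)

theory Defs
  imports
    "HOL-Library.Poly_Mapping"
    "HOL-Computational_Algebra.Polynomial_Factorial"
begin

section \<open>Algebras and finite separable extensions\<close>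

text \<open>
  Vector spaces over a field are given, as in \<^theory>\<open>HOL.Vector_Spaces\<close>, by a scalar
  multiplication on a type. A field extension is a K-algebra whose underlying ring is a field;
  the embedding of the base field is then the map sending c to \<open>scale c 1\<close>.
\<close>

locale k_algebra = vector_space scale
  for scale :: "'k::field \<Rightarrow> 'a::ring_1 \<Rightarrow> 'a" +
  assumes scale_mult_left: "scale c x * y = scale c (x * y)"
    and scale_mult_right: "x * scale c y = scale c (x * y)"

definition is_minimal_polynomial ::
  "('k::field \<Rightarrow> 'l::field \<Rightarrow> 'l) \<Rightarrow> 'l \<Rightarrow> 'k poly \<Rightarrow> bool" where
  "is_minimal_polynomial scale x p \<longleftrightarrow>
     lead_coeff p = 1 \<and> poly (map_poly (\<lambda>c. scale c 1) p) x = 0 \<and>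
     (\<forall>q. poly (map_poly (\<lambda>c. scale c 1) q) x = 0 \<longrightarrow> p dvd q)"

locale finite_separable_extension = k_algebra scale
  for scale :: "'k::field \<Rightarrow> 'l::field \<Rightarrow> 'l" +
  assumes finite_extension: "\<exists>B. finite_dimensional_vector_space scale B"
    and separable_extension:
      "\<exists>p. is_minimal_polynomial scale x p \<and> coprime p (pderiv p)"


section \<open>Tensor products\<close>

text \<open>
  The free vector space on a set of generators is the type of finitely supported functions on it.
  The tensor product of V and W is the quotient of the free vector space on pairs by the bilinear
  relations; its elements are cosets. As usual, functions out of a tensor product are computed on
  a representative; for bilinear data the choice does not matter.
\<close>

definition free_scale :: "'k::field \<Rightarrow> ('p \<Rightarrow>\<^sub>0 'k) \<Rightarrow> ('p \<Rightarrow>\<^sub>0 'k)" where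
  "free_scale c f = Poly_Mapping.map ((*) c) f"

definition linear_extension ::
  "('k::field \<Rightarrow> 'u::ab_group_add \<Rightarrow> 'u) \<Rightarrow> ('p \<Rightarrow> 'u) \<Rightarrow> ('p \<Rightarrow>\<^sub>0 'k) \<Rightarrow> 'u" where
  "linear_extension sU B f = (\<Sum>p\<in>Poly_Mapping.keys f. sU (Poly_Mapping.lookup f p) (B p))"

definition coset :: "'a::ab_group_add set \<Rightarrow> 'a \<Rightarrow> 'a set" where
  "coset N f = {g. g - f \<in> N}"

definition rep :: "'a set \<Rightarrow> 'a" where
  "rep t = (SOME f. f \<in> t)"

definition bilinear_relations ::
  "('k::field \<Rightarrow> 'v::ab_group_add \<Rightarrow> 'v) \<Rightarrow> ('k \<Rightarrow> 'w::ab_group_add \<Rightarrow> 'w) \<Rightarrow> ('v \<times> 'w \<Rightarrow>\<^sub>0 'k) set"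
  where
  "bilinear_relations sV sW = module.span free_scale
     ({Poly_Mapping.single (v + v', w) 1 - Poly_Mapping.single (v, w) 1 - Poly_Mapping.single (v', w) 1 | v v' w. True} \<union>
      {Poly_Mapping.single (v, w + w') 1 - Poly_Mapping.single (v, w) 1 - Poly_Mapping.single (v, w') 1 | v w w'. True} \<union>
      {Poly_Mapping.single (sV c v, w) 1 - Poly_Mapping.single (v, w) c | c v w. True} \<union>
      {Poly_Mapping.single (v, sW c w) 1 - Poly_Mapping.single (v, w) c | c v w. True})"

definition trilinear_relations ::
  "('k::field \<Rightarrow> 'v::ab_group_add \<Rightarrow> 'v) \<Rightarrow> ('v \<times> 'v \<times> 'v \<Rightarrow>\<^sub>0 'k) set" where
  "trilinear_relations s = module.span free_scale
     ({Poly_Mapping.single (u + u', v, w) 1 - Poly_Mapping.single (u, v, w) 1 - Poly_Mapping.single (u', v, w) 1 | u u' v w. True} \<union>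
      {Poly_Mapping.single (u, v + v', w) 1 - Poly_Mapping.single (u, v, w) 1 - Poly_Mapping.single (u, v', w) 1 | u v v' w. True} \<union>
      {Poly_Mapping.single (u, v, w + w') 1 - Poly_Mapping.single (u, v, w) 1 - Poly_Mapping.single (u, v, w') 1 | u v w w'. True} \<union>
      {Poly_Mapping.single (s c u, v, w) 1 - Poly_Mapping.single (u, v, w) c | c u v w. True} \<union>
      {Poly_Mapping.single (u, s c v, w) 1 - Poly_Mapping.single (u, v, w) c | c u v w. True} \<union>
      {Poly_Mapping.single (u, v, s c w) 1 - Poly_Mapping.single (u, v, w) c | c u v w. True})"

type_synonym ('k, 'v, 'w) tensor = "('v \<times> 'w \<Rightarrow>\<^sub>0 'k) set"

definition tensor_class ::
  "('k::field \<Rightarrow> 'v::ab_group_add \<Rightarrow> 'v) \<Rightarrow> ('k \<Rightarrow> 'w::ab_group_add \<Rightarrow> 'w) \<Rightarrow>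
   ('v \<times> 'w \<Rightarrow>\<^sub>0 'k) \<Rightarrow> ('k, 'v, 'w) tensor" where
  "tensor_class sV sW = coset (bilinear_relations sV sW)"

definition tensor_space ::
  "('k::field \<Rightarrow> 'v::ab_group_add \<Rightarrow> 'v) \<Rightarrow> ('k \<Rightarrow> 'w::ab_group_add \<Rightarrow> 'w) \<Rightarrow>
   ('k, 'v, 'w) tensor set" where
  "tensor_space sV sW = range (tensor_class sV sW)"

definition pure_tensor ::
  "('k::field \<Rightarrow> 'v::ab_group_add \<Rightarrow> 'v) \<Rightarrow> ('k \<Rightarrow> 'w::ab_group_add \<Rightarrow> 'w) \<Rightarrow>
   'v \<Rightarrow> 'w \<Rightarrow> ('k, 'v, 'w) tensor" where
  "pure_tensor sV sW v w = tensor_class sV sW (Poly_Mapping.single (v, w) 1)"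

definition tensor_add ::
  "('k::field \<Rightarrow> 'v::ab_group_add \<Rightarrow> 'v) \<Rightarrow> ('k \<Rightarrow> 'w::ab_group_add \<Rightarrow> 'w) \<Rightarrow>
   ('k, 'v, 'w) tensor \<Rightarrow> ('k, 'v, 'w) tensor \<Rightarrow> ('k, 'v, 'w) tensor" where
  "tensor_add sV sW t u = tensor_class sV sW (rep t + rep u)"

definition tensor_scale ::
  "('k::field \<Rightarrow> 'v::ab_group_add \<Rightarrow> 'v) \<Rightarrow> ('k \<Rightarrow> 'w::ab_group_add \<Rightarrow> 'w) \<Rightarrow>
   'k \<Rightarrow> ('k, 'v, 'w) tensor \<Rightarrow> ('k, 'v, 'w) tensor" where
  "tensor_scale sV sW c t = tensor_class sV sW (free_scale c (rep t))"

text \<open>The linear map on the tensor product induced by a bilinear map B into the space with scalar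
  multiplication \<open>sU\<close>.\<close>

definition tensor_lift ::
  "('k::field \<Rightarrow> 'u::ab_group_add \<Rightarrow> 'u) \<Rightarrow> ('v \<Rightarrow> 'w \<Rightarrow> 'u) \<Rightarrow> ('k, 'v, 'w) tensor \<Rightarrow> 'u" where
  "tensor_lift sU B t = linear_extension sU (\<lambda>(v, w). B v w) (rep t)"

text \<open>The product of the tensor square of an algebra, determined by
  (a (x) b)(c (x) d) = ac (x) bd.\<close>

definition tensor_mult ::
  "('k::field \<Rightarrow> 'a::ring_1 \<Rightarrow> 'a) \<Rightarrow> ('k, 'a, 'a) tensor \<Rightarrow> ('k, 'a, 'a) tensor \<Rightarrow> ('k, 'a, 'a) tensor"
  where
  "tensor_mult s t u = tensor_class s s
     (linear_extension free_scale
        (\<lambda>(a, b). linear_extension free_scale (\<lambda>(c, d). Poly_Mapping.single (a * c, b * d) 1) (rep u)) (rep t))"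

text \<open>For a linear map D from H to its tensor square, the maps D (x) id and id (x) D from the
  tensor square of H to its tensor cube.\<close>

definition comult_left ::
  "('k::field \<Rightarrow> 'h::ab_group_add \<Rightarrow> 'h) \<Rightarrow> ('h \<Rightarrow> ('k, 'h, 'h) tensor) \<Rightarrow>
   ('k, 'h, 'h) tensor \<Rightarrow> ('h \<times> 'h \<times> 'h \<Rightarrow>\<^sub>0 'k) set" where
  "comult_left s D t = coset (trilinear_relations s)
     (linear_extension free_scale
        (\<lambda>(a, b). linear_extension free_scale (\<lambda>(c, d). Poly_Mapping.single (c, d, b) 1) (rep (D a))) (rep t))"

definition comult_right ::
  "('k::field \<Rightarrow> 'h::ab_group_add \<Rightarrow> 'h) \<Rightarrow> ('h \<Rightarrow> ('k, 'h, 'h) tensor) \<Rightarrow>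
   ('k, 'h, 'h) tensor \<Rightarrow> ('h \<times> 'h \<times> 'h \<Rightarrow>\<^sub>0 'k) set" where
  "comult_right s D t = coset (trilinear_relations s)
     (linear_extension free_scale
        (\<lambda>(a, b). linear_extension free_scale (\<lambda>(c, d). Poly_Mapping.single (a, c, d) 1) (rep (D b))) (rep t))"


section \<open>Hopf algebras and Hopf-Galois structures\<close>

locale hopf_algebra = k_algebra s
  for s :: "'k::field \<Rightarrow> 'h::ring_1 \<Rightarrow> 'h" +
  fixes comult :: "'h \<Rightarrow> ('k, 'h, 'h) tensor"
    and counit :: "'h \<Rightarrow> 'k"
    and antipode :: "'h \<Rightarrow> 'h"
  assumes comult_in_tensor: "comult a \<in> tensor_space s s"
    and comult_add: "comult (a + b) = tensor_add s s (comult a) (comult b)"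
    and comult_scale: "comult (s c a) = tensor_scale s s c (comult a)"
    and counit_linear: "Vector_Spaces.linear s (*) counit"
    and antipode_linear: "Vector_Spaces.linear s s antipode"
    and coassociative: "comult_left s comult (comult a) = comult_right s comult (comult a)"
    and counit_left: "tensor_lift s (\<lambda>b c. s (counit b) c) (comult a) = a"
    and counit_right: "tensor_lift s (\<lambda>b c. s (counit c) b) (comult a) = a"
    and comult_mult: "comult (a * b) = tensor_mult s (comult a) (comult b)"
    and comult_one: "comult 1 = pure_tensor s s 1 1"
    and counit_mult: "counit (a * b) = counit a * counit b"
    and counit_one: "counit 1 = 1"
    and antipode_left: "tensor_lift s (\<lambda>b c. antipode b * c) (comult a) = s (counit a) 1"
    and antipode_right: "tensor_lift s (\<lambda>b c. b * antipode c) (comult a) = s (counit a) 1"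

locale hopf_module_algebra =
  L: k_algebra sL + H: hopf_algebra sH comult counit antipode
  for sL :: "'k::field \<Rightarrow> 'l::ring_1 \<Rightarrow> 'l"
    and sH :: "'k \<Rightarrow> 'h::ring_1 \<Rightarrow> 'h"
    and comult :: "'h \<Rightarrow> ('k, 'h, 'h) tensor"
    and counit :: "'h \<Rightarrow> 'k"
    and antipode :: "'h \<Rightarrow> 'h" +
  fixes act :: "'h \<Rightarrow> 'l \<Rightarrow> 'l"
  assumes act_linear_left: "Vector_Spaces.linear sH sL (\<lambda>h. act h x)"
    and act_linear_right: "Vector_Spaces.linear sL sL (act h)"
    and act_one: "act 1 x = x"
    and act_mult: "act (g * h) x = act g (act h x)"
    and act_on_mult: "act h (x * y) = tensor_lift sL (\<lambda>g g'. act g x * act g' y) (comult h)"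
    and act_on_one: "act h 1 = sL (counit h) 1"

text \<open>The natural map from the tensor product of L and H to the endomorphisms of L, sending
  l (x) h to the map taking x to l(h.x).\<close>

definition hopf_galois_map ::
  "('k::field \<Rightarrow> 'l::ring_1 \<Rightarrow> 'l) \<Rightarrow> ('h \<Rightarrow> 'l \<Rightarrow> 'l) \<Rightarrow> ('k, 'l, 'h) tensor \<Rightarrow> 'l \<Rightarrow> 'l" where
  "hopf_galois_map sL act t = (\<lambda>x. tensor_lift sL (\<lambda>l h. l * act h x) t)"

locale hopf_galois_structure =
  hopf_module_algebra sL sH comult counit antipode act
  for sL :: "'k::field \<Rightarrow> 'l::field \<Rightarrow> 'l"
    and sH :: "'k \<Rightarrow> 'h::ring_1 \<Rightarrow> 'h"
    and comult :: "'h \<Rightarrow> ('k, 'h, 'h) tensor"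
    and counit :: "'h \<Rightarrow> 'k"
    and antipode :: "'h \<Rightarrow> 'h"
    and act :: "'h \<Rightarrow> 'l \<Rightarrow> 'l" +
  assumes hopf_galois_map_bij:
    "bij_betw (hopf_galois_map sL act) (tensor_space sL sH) {f. Vector_Spaces.linear sL sL f}"

definition generates_module :: "('h \<Rightarrow> 'l \<Rightarrow> 'l) \<Rightarrow> 'l \<Rightarrow> bool" where
  "generates_module act x \<longleftrightarrow> range (\<lambda>h. act h x) = UNIV"

end

(* If H1 x = L, then h x = 0 with h in H2 forces h to annihilate H1 x = L, because the actions
   commute; as H2 acts faithfully, h \<mapsto> h x is injective on H2. Surjectivity of the map
   from L (x) H2 to End(L) forces dim H2 \<ge> dim L, so h \<mapsto> h x is also surjective. *)
theory Submission
  imports Defs "HOL-Library.Function_Algebras"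
begin

lemma sum_fun_apply: "(\<Sum>i\<in>A. f i) y = (\<Sum>i\<in>A. f i y)"
  for f :: "'i \<Rightarrow> 'a \<Rightarrow> 'b::comm_monoid_add"
  by (induction A rule: infinite_finite_induct) simp_all

section \<open>Free vector spaces and linear maps out of tensor products\<close>

lemma lookup_free_scale [simp]:
  "Poly_Mapping.lookup (free_scale c f) p = c * Poly_Mapping.lookup f p"
  by (simp add: free_scale_def map.rep_eq when_def)

lemma vector_space_free_scale: "vector_space (free_scale :: 'k::field \<Rightarrow> ('p \<Rightarrow>\<^sub>0 'k) \<Rightarrow> _)"
  by unfold_locales (auto intro!: poly_mapping_eqI simp: lookup_add algebra_simps)

context vector_space
begin

text \<open>Padding with zero coefficients lets sums over different supports, such as those of f, g
  and f + g, be compared over one index set.\<close>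

lemma linear_extension_superset:
  assumes "finite S" "Poly_Mapping.keys f \<subseteq> S"
  shows "linear_extension scale B f = (\<Sum>p\<in>S. scale (Poly_Mapping.lookup f p) (B p))"
  unfolding linear_extension_def
  by (rule sum.mono_neutral_left) (use assms in \<open>auto simp: in_keys_iff\<close>)

lemma linear_linear_extension:
  fixes B :: "'p \<Rightarrow> 'b"
  shows "Vector_Spaces.linear free_scale scale (linear_extension scale B)"
proof -
  interpret free: vector_space "free_scale :: 'a \<Rightarrow> ('p \<Rightarrow>\<^sub>0 'a) \<Rightarrow> _"
    by (rule vector_space_free_scale)
  have add: "linear_extension scale B (f + g) = linear_extension scale B f + linear_extension scale B g"
    for f g :: "'p \<Rightarrow>\<^sub>0 'a"
  proof -
    let ?S = "Poly_Mapping.keys f \<union> Poly_Mapping.keys g"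
    have "Poly_Mapping.keys (f + g) \<subseteq> ?S"
      by (rule keys_add)
    then show ?thesis
      by (simp add: linear_extension_superset[of ?S] lookup_add scale_left_distrib sum.distrib)
  qed
  have scale: "linear_extension scale B (free_scale c f) = scale c (linear_extension scale B f)"
    for c and f :: "'p \<Rightarrow>\<^sub>0 'a"
  proof -
    have "Poly_Mapping.keys (free_scale c f) \<subseteq> Poly_Mapping.keys f"
      by (auto simp: in_keys_iff)
    then show ?thesis
      by (simp add: linear_extension_superset[of "Poly_Mapping.keys f"] scale_sum_right)
  qed
  show ?thesis
    by unfold_locales (simp_all add: add scale)
qed

lemma linear_extension_single [simp]:
  "linear_extension scale B (Poly_Mapping.single p c) = scale c (B p)"
  by (simp add: linear_extension_superset[of "{p}"])

text \<open>The relations form a span, so by linearity it suffices to look at the four families of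
  generators, and each of these vanishes by bilinearity of \<open>B\<close>.\<close>

lemma linear_extension_bilinear_relations:
  fixes B :: "'v::ab_group_add \<Rightarrow> 'w::ab_group_add \<Rightarrow> 'b"
  assumes left: "\<And>w. Vector_Spaces.linear sV scale (\<lambda>v. B v w)"
    and right: "\<And>v. Vector_Spaces.linear sW scale (B v)"
    and r: "r \<in> bilinear_relations sV sW"
  shows "linear_extension scale (\<lambda>(v, w). B v w) r = 0"
proof -
  interpret free: vector_space "free_scale :: 'a \<Rightarrow> ('v \<times> 'w \<Rightarrow>\<^sub>0 'a) \<Rightarrow> _"
    by (rule vector_space_free_scale)
  interpret E: Vector_Spaces.linear free_scale scale "linear_extension scale (\<lambda>(v, w). B v w)"
    by (rule linear_linear_extension)
  interpret left: Vector_Spaces.linear sV scale "\<lambda>v. B v w" for w by (rule left)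
  interpret right: Vector_Spaces.linear sW scale "B v" for v by (rule right)
  show ?thesis
    using r unfolding bilinear_relations_def
  by (rule E.eq_0_on_span[rotated]) (auto simp: E.diff left.add left.scale right.add right.scale)
qed

text \<open>The representative picked by \<open>rep\<close> differs from \<open>f\<close> by a
  relation, which the extension of \<open>B\<close> kills. Hence maps out of the tensor product may
  be computed on any representative.\<close>

lemma tensor_lift_tensor_class:
  fixes B :: "'v::ab_group_add \<Rightarrow> 'w::ab_group_add \<Rightarrow> 'b"
  assumes left: "\<And>w. Vector_Spaces.linear sV scale (\<lambda>v. B v w)"
    and right: "\<And>v. Vector_Spaces.linear sW scale (B v)"
  shows "tensor_lift scale B (tensor_class sV sW f) = linear_extension scale (\<lambda>(v, w). B v w) f"
proof -
  interpret free: vector_space "free_scale :: 'a \<Rightarrow> ('v \<times> 'w \<Rightarrow>\<^sub>0 'a) \<Rightarrow> _"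
    by (rule vector_space_free_scale)
  interpret E: Vector_Spaces.linear free_scale scale "linear_extension scale (\<lambda>(v, w). B v w)"
    by (rule linear_linear_extension)
  have "f \<in> tensor_class sV sW f"
    by (simp add: tensor_class_def coset_def bilinear_relations_def free.span_zero)
  then have "rep (tensor_class sV sW f) \<in> tensor_class sV sW f"
    unfolding rep_def by (rule someI)
  then have "rep (tensor_class sV sW f) - f \<in> bilinear_relations sV sW"
    by (simp add: tensor_class_def coset_def)
  from linear_extension_bilinear_relations[OF left right this]
  show ?thesis
    by (simp add: tensor_lift_def E.diff)
qed

end

section \<open>The Hopf-Galois map: faithfulness and dimension\<close>

context hopf_galois_structure
begin

lemma linear_mult_act_left: "Vector_Spaces.linear sL sL (\<lambda>l. l * act h y)"
  by unfold_locales (simp_all add: distrib_right L.scale_mult_left)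

lemma linear_mult_act_right: "Vector_Spaces.linear sH sL (\<lambda>h. l * act h y)"
proof -
  interpret A: Vector_Spaces.linear sH sL "\<lambda>h. act h y" by (rule act_linear_left)
  show ?thesis
    by unfold_locales (simp_all add: A.add A.scale distrib_left L.scale_mult_right)
qed

lemma hopf_galois_map_tensor_class:
  "hopf_galois_map sL act (tensor_class sL sH f) y =
     linear_extension sL (\<lambda>(l, h). l * act h y) f"
  unfolding hopf_galois_map_def
  by (rule L.tensor_lift_tensor_class[OF linear_mult_act_left linear_mult_act_right])

text \<open>If h annihilates L, injectivity of the Hopf-Galois map identifies 1 (x) h with 1 (x) 0;
  a linear map undoing g \<mapsto> 1 (x) g then gives h = 0.\<close>

lemma act_faithful:
  assumes "\<And>y. act h y = 0"
  shows "h = 0"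
proof -
  interpret LK: vector_space_pair sL "(*) :: 'k \<Rightarrow> 'k \<Rightarrow> 'k"
    by unfold_locales (simp_all add: algebra_simps)
  interpret A: Vector_Spaces.linear sH sL "\<lambda>h. act h y" for y by (rule act_linear_left)
  \<comment> \<open>The zero tensor is written as 1 (x) 0 so that the same recovery formula applies
    to both sides.\<close>
  have "tensor_class sL sH (Poly_Mapping.single (1, h) 1) = tensor_class sL sH (Poly_Mapping.single (1, 0) 1)"
  proof (rule inj_onD[OF bij_betw_imp_inj_on[OF hopf_galois_map_bij]])
    show "hopf_galois_map sL act (tensor_class sL sH (Poly_Mapping.single (1, h) 1)) =
        hopf_galois_map sL act (tensor_class sL sH (Poly_Mapping.single (1, 0) 1))"
      by (simp add: fun_eq_iff hopf_galois_map_tensor_class assms A.zero)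
  qed (simp_all add: tensor_space_def)
  \<comment> \<open>A functional \<open>\<phi>\<close> with \<open>\<phi> 1 = 1\<close> gives a map l (x) h \<open>\<mapsto>\<close> \<open>\<phi>\<close>(l) h that recovers h from 1 (x) h.\<close>
  moreover obtain \<phi> where \<phi>: "Vector_Spaces.linear sL (*) \<phi>" "\<phi> 1 = (1 :: 'k)"
    using LK.linear_independent_extend[of "{1}" "\<lambda>_. 1"] by auto
  interpret \<phi>: Vector_Spaces.linear sL "(*) :: 'k \<Rightarrow> 'k \<Rightarrow> 'k" \<phi> by (rule \<phi>)
  have left: "Vector_Spaces.linear sL sH (\<lambda>l. sH (\<phi> l) g)" for g
    by unfold_locales (simp_all add: \<phi>.add \<phi>.scale H.scale_left_distrib)
  have right: "Vector_Spaces.linear sH sH (\<lambda>g. sH (\<phi> l) g)" for l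
    by unfold_locales (simp_all add: H.scale_right_distrib mult.commute)
  have "tensor_lift sH (\<lambda>l g. sH (\<phi> l) g) (tensor_class sL sH (Poly_Mapping.single (1, g) 1)) = g" for g
    by (simp add: H.tensor_lift_tensor_class[OF left right] \<phi>(2))
  ultimately show ?thesis by metis
qed

text \<open>Both sides of L (x) H = End(L) are compared over L rather than over K: the coordinate
  functionals of a K-basis of L are L-independent.\<close>

lemma card_basis_le_card_spanning:
  assumes "finite_dimensional_vector_space sL B" "finite C" "H.span C = UNIV"
  shows "card B \<le> card C"
proof -
  interpret F: finite_dimensional_vector_space sL B by (rule assms(1))
  \<comment> \<open>All maps L \<rightarrow> L, as a vector space over L with pointwise
    scaling.\<close>
  interpret Fun: vector_space "\<lambda>(l::'l) (f :: 'l \<Rightarrow> 'l). (\<lambda>y. l * f y)"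
    by unfold_locales (auto simp: fun_eq_iff algebra_simps)
  \<comment> \<open>A scalar c of K acts as multiplication by \<open>sL c 1\<close>, so
    K-combinations in H become L-combinations of operators.\<close>
  have act_span: "act h \<in> Fun.span (act ` C)" for h
  proof -
    interpret A: Vector_Spaces.linear sH sL "\<lambda>h. act h y" for y by (rule act_linear_left)
    have "h \<in> H.span C" by (simp add: assms(3))
    then show ?thesis
    proof (induction rule: H.span_induct_alt)
      case base
      have "act 0 = 0" by (simp add: fun_eq_iff A.zero)
      then show ?case by (metis Fun.span_zero)
    next
      case (step c g h)
      have "act (sH c g + h) = (\<lambda>y. sL c 1 * act g y) + act h"
        by (simp add: fun_eq_iff A.add A.scale L.scale_mult_left)
      moreover have "(\<lambda>y. sL c 1 * act g y) + act h \<in> Fun.span (act ` C)"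
        using step by (intro Fun.span_add Fun.span_scale) (simp_all add: Fun.span_base)
      ultimately show ?case by metis
    qed
  qed
  \<comment> \<open>Here surjectivity of the Hopf-Galois map enters: each endomorphism is a sum of
    terms l (h y), an L-combination of operators.\<close>
  have linear_span: "f \<in> Fun.span (act ` C)" if "Vector_Spaces.linear sL sL f" for f
  proof -
    have "f \<in> hopf_galois_map sL act ` tensor_space sL sH"
      using that hopf_galois_map_bij by (simp add: bij_betw_def)
    then obtain t where t: "f = hopf_galois_map sL act (tensor_class sL sH t)"
      by (auto simp: tensor_space_def)
    have "f = (\<Sum>p\<in>Poly_Mapping.keys t. (\<lambda>y. sL (Poly_Mapping.lookup t p) (fst p) * act (snd p) y))"
      by (simp add: fun_eq_iff t hopf_galois_map_tensor_class linear_extension_def sum_fun_apply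
          split_beta L.scale_mult_left)
    then show ?thesis
      by (simp add: Fun.span_sum Fun.span_scale act_span)
  qed
  \<comment> \<open>The coordinate functional at \<open>b\<close>, with its values moved from K into
    L.\<close>
  define e where "e b y = sL (L.representation B y b) 1" for b y
  have e_basis: "e b b' = (if b = b' then 1 else 0)" if "b' \<in> B" for b b'
    using that by (simp add: e_def L.representation_basis[OF F.independent_Basis])
  have "inj_on e B"
    by (rule inj_onI) (metis e_basis zero_neq_one)
  moreover have "Fun.independent (e ` B)"
  proof (rule Fun.independent_if_scalars_zero)
    fix u f
    assume 0: "(\<Sum>f\<in>e ` B. (\<lambda>y. u f * f y)) = 0" and "f \<in> e ` B"
    then obtain b where b: "b \<in> B" "f = e b" by auto
    have "0 = (\<Sum>f\<in>e ` B. (\<lambda>y. u f * f y)) b" by (simp add: 0)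
    \<comment> \<open>Evaluation at the basis vector \<open>b\<close> isolates the coefficient of
      \<open>e b\<close>.\<close>
    also have "\<dots> = (\<Sum>b'\<in>B. u (e b') * e b' b)"
      by (simp add: sum_fun_apply sum.reindex[OF \<open>inj_on e B\<close>])
    also have "\<dots> = u f"
      using b F.finite_Basis by (simp add: e_basis if_distrib[of "\<lambda>x. _ * x"] cong: if_cong)
    finally show "u f = 0" by simp
  qed (simp add: F.finite_Basis)
  moreover have "e ` B \<subseteq> Fun.span (act ` C)"
  proof clarify
    fix b
    have "Vector_Spaces.linear sL sL (e b)"
      by unfold_locales
        (simp_all add: e_def L.representation_add L.representation_scale F.independent_Basis
          F.span_Basis L.scale_left_distrib)
    then show "e b \<in> Fun.span (act ` C)" by (rule linear_span)
  qed
  ultimately have "card B \<le> card (act ` C)"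
    using Fun.independent_span_bound[of "act ` C" "e ` B"] assms(2)
    by (simp add: card_image)
  also have "\<dots> \<le> card C" by (rule card_image_le[OF assms(2)])
  finally show ?thesis .
qed

text \<open>The map h \<mapsto> h x carries a K-basis of H to an independent set in L, and the
  preceding bound makes that set large enough to span L.\<close>

lemma generates_module_if_inj:
  assumes "finite_dimensional_vector_space sL B" "inj (\<lambda>h. act h x)"
  shows "generates_module act x"
proof -
  interpret F: finite_dimensional_vector_space sL B by (rule assms(1))
  interpret A: Vector_Spaces.linear sH sL "\<lambda>h. act h x" by (rule act_linear_left)
  obtain C where C: "H.independent C" "H.span C = UNIV"
    using H.basis_exists[of UNIV] by (metis top.extremum_uniqueI)
  let ?D = "(\<lambda>h. act h x) ` C"
  have D: "L.independent ?D"
    using C(1) assms(2) by (simp add: A.independent_injective_image inj_on_subset)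
  \<comment> \<open>Finiteness of H over K is not given; it is pulled back from L along the
    injection.\<close>
  then have "finite ?D" by (rule F.finiteI_independent)
  moreover have inj: "inj_on (\<lambda>h. act h x) C" using assms(2) by (rule inj_on_subset) simp
  ultimately have "finite C" by (rule finite_imageD)
  with C have "card B \<le> card C" by (intro card_basis_le_card_spanning assms(1))
  then have "L.dim UNIV \<le> card ?D"
    by (simp add: F.dim_UNIV F.dimension_def card_image[OF inj])
  then have "L.span ?D = UNIV"
    using F.card_ge_dim_independent[of ?D UNIV] D by auto
  moreover have "L.span ?D \<subseteq> range (\<lambda>h. act h x)"
    by (simp add: A.span_image image_mono)
  ultimately show ?thesis by (auto simp: generates_module_def)
qed

end

text \<open>The two actions enter asymmetrically, so that exchanging their roles yields both
  directions of the equivalence.\<close>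

lemma generates_module_of_commuting:
  assumes "finite_dimensional_vector_space sL B"
    and "hopf_galois_structure sL s comult counit antipode act"
    and comm: "\<And>g h y. act' g (act h y) = act h (act' g y)"
    and zero: "\<And>g. act' g 0 = 0"
    and gen: "generates_module act' x"
  shows "generates_module act x"
proof -
  interpret G: hopf_galois_structure sL s comult counit antipode act by fact
  interpret A: Vector_Spaces.linear s sL "\<lambda>h. act h x" by (rule G.act_linear_left)
  have "h = 0" if "act h x = 0" for h
  proof (rule G.act_faithful)
    fix y
    \<comment> \<open>With y = g x, commutation gives h y = g (h x) = g 0 = 0.\<close>
    obtain g where "y = act' g x" using gen by (auto simp: generates_module_def)
    then show "act h y = 0" using that zero by (simp flip: comm)
  qed
  then have "inj (\<lambda>h. act h x)" by (simp add: A.inj_iff_eq_0)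
  then show ?thesis by (rule G.generates_module_if_inj[OF assms(1)])
qed

theorem theorem1p1:
  fixes sL :: "'k::field \<Rightarrow> 'l::field \<Rightarrow> 'l"
    and s1 :: "'k \<Rightarrow> 'h1::ring_1 \<Rightarrow> 'h1"
    and s2 :: "'k \<Rightarrow> 'h2::ring_1 \<Rightarrow> 'h2"
    and comult1 :: "'h1 \<Rightarrow> ('k, 'h1, 'h1) tensor"
    and comult2 :: "'h2 \<Rightarrow> ('k, 'h2, 'h2) tensor"
    and counit1 :: "'h1 \<Rightarrow> 'k" and counit2 :: "'h2 \<Rightarrow> 'k"
    and antipode1 :: "'h1 \<Rightarrow> 'h1" and antipode2 :: "'h2 \<Rightarrow> 'h2"
    and act1 :: "'h1 \<Rightarrow> 'l \<Rightarrow> 'l" and act2 :: "'h2 \<Rightarrow> 'l \<Rightarrow> 'l"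
    and x :: 'l
  assumes "finite_separable_extension sL"
    and "hopf_galois_structure sL s1 comult1 counit1 antipode1 act1"
    and "hopf_galois_structure sL s2 comult2 counit2 antipode2 act2"
    and "\<And>h1 h2 y. act1 h1 (act2 h2 y) = act2 h2 (act1 h1 y)"
  shows "generates_module act1 x \<longleftrightarrow> generates_module act2 x"
proof -
  obtain B where B: "finite_dimensional_vector_space sL B"
    using finite_separable_extension.finite_extension[OF assms(1)] by blast
  interpret G1: hopf_galois_structure sL s1 comult1 counit1 antipode1 act1 by fact
  interpret G2: hopf_galois_structure sL s2 comult2 counit2 antipode2 act2 by fact
  interpret A1: Vector_Spaces.linear sL sL "act1 h" for h by (rule G1.act_linear_right)
  interpret A2: Vector_Spaces.linear sL sL "act2 h" for h by (rule G2.act_linear_right)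
  show ?thesis
  proof
    assume "generates_module act1 x"
    with B assms(3,4) A1.zero show "generates_module act2 x"
      by (rule generates_module_of_commuting)
  next
    assume "generates_module act2 x"
    with B assms(2) assms(4)[symmetric] A2.zero show "generates_module act1 x"
      by (rule generates_module_of_commuting)
  qed
qed

end
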